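(* For a set $X$ of real numbers, the following are equivalent: (1) $X$ satisfies $\mathsf{S}_1(\mathcal{B}_\Gamma,\mathcal{B}_{\mathrm{T}^*})$; (2) $X$ satisfies $\mathsf{S}_{fin}(\mathcal{B}_\Gamma,\mathcal{B}_{\mathrm{T}^*})$; (3) $X$ satisfies $\mathsf{U}_{fin}(\mathcal{B}_\Gamma,\mathcal{B}_{\mathrm{T}^*})$; (4) every Borel image of $X$ in $\mathbb{N}^\mathbb{N}$ satisfies the weak excluded middle property.
   Context: All spaces $X$ are infinite sets of reals; all covers are assumed not to contain $X$ as a member. A cover is a $\gamma$-cover of $X$ if it is infinite and each point lies in all but finitely many members; large if each point lies in infinitely many members. $[\mathbb{N}]^\infty$ is the space of infinite subsets of $\mathbb{N}$; $a\subseteq^*b$ means $a\setminus b$ finite. $Y\subseteq[\mathbb{N}]^\infty$ is linearly refinable if for each $y\in Y$ there is an infinite $\hat y\subseteq y$ such that $\{\hat y:y\in Y\}$ is linearly quasiordered by $\subseteq^*$. For a countable cover enumerated bijectively as $\mathcal{U}=\{U_n:n\in\mathbb{N}\}$, $h_\mathcal{U}(x)=\{n:x\in U_n\}$. A cover $\mathcal{U}$ is a $\tau^*$-cover if it is large and $h_\mathcal{U}[X]$ is linearly refinable. $\mathcal{B}_\Gamma$ and $\mathcal{B}_{\mathrm{T}^*}$ are the collections of countable Borel $\gamma$-covers and countable Borel $\tau^*$-covers of $X$. $X$ satisfies $\mathsf{S}_1(\mathfrak{U},\mathfrak{V})$ if for every sequence $(\mathcal{U}_n)$ of members of $\mathfrak{U}$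 there are $U_n\in\mathcal{U}_n$ with $\{U_n:n\in\mathbb{N}\}\in\mathfrak{V}$; $\mathsf{S}_{fin}(\mathfrak{U},\mathfrak{V})$ if there are finite (possibly empty) $\mathcal{F}_n\subseteq\mathcal{U}_n$ with $\bigcup_n\mathcal{F}_n\in\mathfrak{V}$; $\mathsf{U}_{fin}(\mathfrak{U},\mathfrak{V})$ if for every sequence $(\mathcal{U}_n)$ of members of $\mathfrak{U}$ none of which contains a finite subcover there are finite (possibly empty) $\mathcal{F}_n\subseteq\mathcal{U}_n$ with $\{\bigcup\mathcal{F}_n:n\in\mathbb{N}\}\in\mathfrak{V}$. For $f,h\in\mathbb{N}^\mathbb{N}$, $[f\le h]=\{n:f(n)\le h(n)\}$. $Y\subseteq\mathbb{N}^\mathbb{N}$ satisfies the weak excluded middle property if there is $h\in\mathbb{N}^\mathbb{N}$ such that each $[f\le h]$, $f\in Y$, is infinite and $\{[f\le h]:f\in Y\}$ is linearly refinable. A Borel image of $X$ in $Z$ is $f[X]$ for a Borel $f:X\to Z$. *)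

theory Defs
  imports "HOL-Analysis.Analysis"
begin

definition almost_subset :: "nat set \<Rightarrow> nat set \<Rightarrow> bool" (infix "\<subseteq>\<^sup>*" 50)
  where "a \<subseteq>\<^sup>* b \<longleftrightarrow> finite (a - b)"

(* The relation is always reflexive and transitive, so being linearly quasiordered by it
   amounts to any two elements being comparable. *)
definition linearly_quasiordered :: "nat set set \<Rightarrow> bool"
  where "linearly_quasiordered Z \<longleftrightarrow> (\<forall>a\<in>Z. \<forall>b\<in>Z. a \<subseteq>\<^sup>* b \<or> b \<subseteq>\<^sup>* a)"

(* The function r maps y to its refinement; it forces all members of Y to be infinite. *)
definition linearly_refinable :: "nat set set \<Rightarrow> bool"
  where "linearly_refinable Y \<longleftrightarrow>
    (\<exists>r. (\<forall>y\<in>Y. infinite (r y) \<and> r y \<subseteq> y) \<and> linearly_quasiordered (r ` Y))"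

(* A cover of X consists of subsets of X and does not have X itself as a member. *)
definition is_cover :: "'a set \<Rightarrow> 'a set set \<Rightarrow> bool"
  where "is_cover X \<U> \<longleftrightarrow> \<Union>\<U> = X \<and> X \<notin> \<U>"

definition large_cover :: "'a set \<Rightarrow> 'a set set \<Rightarrow> bool"
  where "large_cover X \<U> \<longleftrightarrow> is_cover X \<U> \<and> (\<forall>x\<in>X. infinite {U \<in> \<U>. x \<in> U})"

definition gamma_cover :: "'a set \<Rightarrow> 'a set set \<Rightarrow> bool"
  where "gamma_cover X \<U> \<longleftrightarrow>
    is_cover X \<U> \<and> infinite \<U> \<and> (\<forall>x\<in>X. finite {U \<in> \<U>. x \<notin> U})"

definition marczewski_map :: "(nat \<Rightarrow> 'a set) \<Rightarrow> 'a \<Rightarrow> nat set"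
  where "marczewski_map u x = {n. x \<in> u n}"

(* The choice of the bijective enumeration u is immaterial: permuting the indices preserves
   linear refinability. *)
definition tau_star_cover :: "'a set \<Rightarrow> 'a set set \<Rightarrow> bool"
  where "tau_star_cover X \<U> \<longleftrightarrow> large_cover X \<U> \<and>
    (\<exists>u. bij_betw u (UNIV :: nat set) \<U> \<and> linearly_refinable (marczewski_map u ` X))"

(* Members of a Borel cover of X are Borel in the subspace X. *)
definition countable_borel_family :: "'a::topological_space set \<Rightarrow> 'a set set \<Rightarrow> bool"
  where "countable_borel_family X \<U> \<longleftrightarrow>
    countable \<U> \<and> \<U> \<subseteq> sets (restrict_space borel X)"

definition borel_gamma_covers :: "'a::topological_space set \<Rightarrow> 'a set set set"
  where "borel_gamma_covers X = {\<U>. countable_borel_family X \<U> \<and> gamma_cover X \<U>}"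

definition borel_tau_star_covers :: "'a::topological_space set \<Rightarrow> 'a set set set"
  where "borel_tau_star_covers X = {\<U>. countable_borel_family X \<U> \<and> tau_star_cover X \<U>}"

definition S_one :: "'a set set set \<Rightarrow> 'a set set set \<Rightarrow> bool"
  where "S_one \<AA> \<BB> \<longleftrightarrow>
    (\<forall>\<U> :: nat \<Rightarrow> 'a set set. (\<forall>n. \<U> n \<in> \<AA>) \<longrightarrow>
      (\<exists>u. (\<forall>n. u n \<in> \<U> n) \<and> range u \<in> \<BB>))"

definition S_fin :: "'a set set set \<Rightarrow> 'a set set set \<Rightarrow> bool"
  where "S_fin \<AA> \<BB> \<longleftrightarrow>
    (\<forall>\<U> :: nat \<Rightarrow> 'a set set. (\<forall>n. \<U> n \<in> \<AA>) \<longrightarrow>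
      (\<exists>\<F>. (\<forall>n. finite (\<F> n) \<and> \<F> n \<subseteq> \<U> n) \<and> (\<Union>n. \<F> n) \<in> \<BB>))"

definition U_fin :: "'a set \<Rightarrow> 'a set set set \<Rightarrow> 'a set set set \<Rightarrow> bool"
  where "U_fin X \<AA> \<BB> \<longleftrightarrow>
    (\<forall>\<U> :: nat \<Rightarrow> 'a set set.
      (\<forall>n. \<U> n \<in> \<AA> \<and> \<not> (\<exists>\<G>. finite \<G> \<and> \<G> \<subseteq> \<U> n \<and> \<Union>\<G> = X)) \<longrightarrow>
      (\<exists>\<F>. (\<forall>n. finite (\<F> n) \<and> \<F> n \<subseteq> \<U> n) \<and> range (\<lambda>n. \<Union>(\<F> n)) \<in> \<BB>))"

definition le_set :: "(nat \<Rightarrow> nat) \<Rightarrow> (nat \<Rightarrow> nat) \<Rightarrow> nat set"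
  where "le_set f h = {n. f n \<le> h n}"

definition weak_excluded_middle :: "(nat \<Rightarrow> nat) set \<Rightarrow> bool"
  where "weak_excluded_middle Y \<longleftrightarrow>
    (\<exists>h. (\<forall>f\<in>Y. infinite (le_set f h)) \<and> linearly_refinable ((\<lambda>f. le_set f h) ` Y))"

(* On nat => nat, borel is generated by the product topology with discrete factors. *)
definition borel_image_in_Baire :: "'a::topological_space set \<Rightarrow> (nat \<Rightarrow> nat) set \<Rightarrow> bool"
  where "borel_image_in_Baire X Y \<longleftrightarrow>
    (\<exists>f \<in> borel_measurable (restrict_space borel X). Y = f ` X)"

end

(* A member of a gamma-cover enumerated as U_0, U_1, ... contains x once its index exceeds some
   f x; so a sequence of gamma-covers codes a Borel map f into the Baire space, and a witness h
   of the weak excluded middle property for its image selects the members of index h(n).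
   Enlarging h does no harm, so the selected members can be made pairwise distinct.

   Conversely, a Borel map f yields the increasing covers {x. f x n <= m}, where the finitely
   many bounded coordinates n may be ignored; if there are infinitely many, they serve as a common
   refinement. Each member of a selected tau*-cover lies below {x. f x n <= h n} for some n, and
   only finitely many members are assigned to the same n. Images under such finite-to-one index
   maps preserve infinite sets and almost inclusion. *)
theory Submission
  imports Defs
begin

section \<open>Refinements indexed by points, and their images\<close>

text \<open>The definition refines sets, while the proof produces a refinement \<open>R x\<close>
  for each point. Points with the same value \<open>g x\<close> may have different
  \<open>R x\<close>, so \<open>inv_into\<close> fixes one representative point for each
  value.\<close>

lemma linearly_refinable_imageI:
  assumes "\<And>x. x \<in> X \<Longrightarrow> infinite (R x) \<and> R x \<subseteq> g x"
    and "\<And>x y. x \<in> X \<Longrightarrow> y \<in> X \<Longrightarrow> R x \<subseteq>\<^sup>* R y \<or> R y \<subseteq>\<^sup>* R x"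
  shows "linearly_refinable (g ` X)"
  unfolding linearly_refinable_def linearly_quasiordered_def
proof (intro exI[of _ "\<lambda>y. R (inv_into X g y)"] conjI ballI)
  fix y assume y: "y \<in> g ` X"
  note inv = inv_into_into[OF y] f_inv_into_f[OF y]
  show "infinite (R (inv_into X g y))" "R (inv_into X g y) \<subseteq> y"
    using assms(1)[OF inv(1)] inv(2) by auto
next
  fix a b
  assume "a \<in> (\<lambda>y. R (inv_into X g y)) ` g ` X" "b \<in> (\<lambda>y. R (inv_into X g y)) ` g ` X"
  then obtain y z where "y \<in> g ` X" "a = R (inv_into X g y)" "z \<in> g ` X" "b = R (inv_into X g z)"
    by blast
  then show "a \<subseteq>\<^sup>* b \<or> b \<subseteq>\<^sup>* a"
    using assms(2) inv_into_into by metis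
qed

lemma linearly_refinable_imageE:
  assumes "linearly_refinable (g ` X)"
  obtains R where "\<forall>x\<in>X. infinite (R x) \<and> R x \<subseteq> g x"
    and "\<forall>x\<in>X. \<forall>y\<in>X. R x \<subseteq>\<^sup>* R y \<or> R y \<subseteq>\<^sup>* R x"
proof -
  from assms obtain r where "\<forall>y\<in>g ` X. infinite (r y) \<and> r y \<subseteq> y"
    and "linearly_quasiordered (r ` g ` X)"
    unfolding linearly_refinable_def by blast
  then show thesis
    by (intro that[of "\<lambda>x. r (g x)"]) (auto simp: linearly_quasiordered_def)
qed

lemma almost_subset_image: "a \<subseteq>\<^sup>* b \<Longrightarrow> s ` a \<subseteq>\<^sup>* s ` b"
  unfolding almost_subset_def
  by (rule finite_subset[of _ "s ` (a - b)"]) auto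

lemma infinite_image_finite_fibres:
  assumes "\<And>n. finite (s -` {n})" and "infinite a"
  shows "infinite (s ` a)"
proof
  assume "finite (s ` a)"
  then have "finite (\<Union>n\<in>s ` a. s -` {n})"
    using assms(1) by (rule finite_UN_I)
  moreover have "a \<subseteq> (\<Union>n\<in>s ` a. s -` {n})"
    by auto
  ultimately show False
    using assms(2) finite_subset by blast
qed

section \<open>From tau*-covers to the weak excluded middle property\<close>

lemma weak_excluded_middle_imageI:
  assumes "\<And>x. x \<in> X \<Longrightarrow> infinite (R x) \<and> R x \<subseteq> le_set (f x) h"
    and "\<And>x y. x \<in> X \<Longrightarrow> y \<in> X \<Longrightarrow> R x \<subseteq>\<^sup>* R y \<or> R y \<subseteq>\<^sup>* R x"
  shows "weak_excluded_middle (f ` X)"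
  unfolding weak_excluded_middle_def image_image
proof (intro exI[of _ h] conjI ballI)
  show "linearly_refinable ((\<lambda>x. le_set (f x) h) ` X)"
    using assms by (rule linearly_refinable_imageI)
next
  fix y assume "y \<in> f ` X"
  then show "infinite (le_set y h)"
    using assms(1) infinite_super by blast
qed

text \<open>The refinement \<open>R x\<close> of the cover, a set of indices of members, is pushed
  forward along \<open>k \<mapsto> c (v k)\<close> to a set of coordinates. The image lies in
  \<open>le_set (f x) h\<close> by \<open>assign\<close>, and it stays infinite because the fibres
  of this map are finite.\<close>

lemma weak_excluded_middle_if_tau_star_cover:
  assumes "tau_star_cover X \<V>"
    and assign: "\<And>V. V \<in> \<V> \<Longrightarrow> V \<subseteq> {x. f x (c V) \<le> h (c V)}"
    and fibres: "\<And>n. finite {V \<in> \<V>. c V = n}"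
  shows "weak_excluded_middle (f ` X)"
proof -
  from assms(1) obtain v where v: "bij_betw v (UNIV :: nat set) \<V>"
    and "linearly_refinable (marczewski_map v ` X)"
    unfolding tau_star_cover_def by blast
  from this(2) obtain R where R: "\<And>x. x \<in> X \<Longrightarrow> infinite (R x) \<and> R x \<subseteq> marczewski_map v x"
    and lin: "\<And>x y. x \<in> X \<Longrightarrow> y \<in> X \<Longrightarrow> R x \<subseteq>\<^sup>* R y \<or> R y \<subseteq>\<^sup>* R x"
    by (rule linearly_refinable_imageE) blast
  have vV: "v k \<in> \<V>" for k
    using v by (auto simp: bij_betw_def)
  have fin: "finite ((\<lambda>k. c (v k)) -` {n})" for n
  proof -
    have "(\<lambda>k. c (v k)) -` {n} = v -` {V \<in> \<V>. c V = n}"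
      using vV by auto
    moreover have "finite (v -` {V \<in> \<V>. c V = n})"
      using fibres v by (intro finite_vimageI) (auto simp: bij_betw_def)
    ultimately show ?thesis
      by simp
  qed
  show ?thesis
  proof (rule weak_excluded_middle_imageI[of _ "\<lambda>x. (\<lambda>k. c (v k)) ` R x"])
    fix x assume x: "x \<in> X"
    have "(\<lambda>k. c (v k)) ` R x \<subseteq> le_set (f x) h"
    proof
      fix n assume "n \<in> (\<lambda>k. c (v k)) ` R x"
      then obtain k where "n = c (v k)" "x \<in> v k"
        using R[OF x] by (auto simp: marczewski_map_def)
      then show "n \<in> le_set (f x) h"
        using assign[OF vV[of k]] by (auto simp: le_set_def)
    qed
    moreover have "infinite ((\<lambda>k. c (v k)) ` R x)"
      using fin R[OF x] by (intro infinite_image_finite_fibres) auto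
    ultimately show "infinite ((\<lambda>k. c (v k)) ` R x) \<and> (\<lambda>k. c (v k)) ` R x \<subseteq> le_set (f x) h"
      by simp
  next
    fix x y assume "x \<in> X" "y \<in> X"
    from lin[OF this] show "(\<lambda>k. c (v k)) ` R x \<subseteq>\<^sup>* (\<lambda>k. c (v k)) ` R y
      \<or> (\<lambda>k. c (v k)) ` R y \<subseteq>\<^sup>* (\<lambda>k. c (v k)) ` R x"
      by (elim disjE) (simp_all add: almost_subset_image)
  qed
qed

section \<open>Covers by the sublevel sets of a function\<close>

definition level_cover :: "'a set \<Rightarrow> ('a \<Rightarrow> nat) \<Rightarrow> 'a set set"
  where "level_cover X g = range (\<lambda>m. {x \<in> X. g x \<le> m})"

text \<open>Sublevel sets form a chain, so the largest of the finitely many levels involved works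
  for all.\<close>

lemma finite_subset_level_cover:
  assumes "finite \<F>" and "\<F> \<subseteq> level_cover X g"
  shows "\<exists>m. \<forall>V\<in>\<F>. V \<subseteq> {x \<in> X. g x \<le> m}"
  using assms
proof (induction)
  case (insert V \<F>)
  then obtain m k where "\<forall>V\<in>\<F>. V \<subseteq> {x \<in> X. g x \<le> m}" "V = {x \<in> X. g x \<le> k}"
    by (auto simp: level_cover_def)
  then have "\<forall>W\<in>insert V \<F>. W \<subseteq> {x \<in> X. g x \<le> max m k}"
    by (auto simp: le_max_iff_disj)
  then show ?case
    by blast
qed simp

lemma no_finite_subcover_level_cover:
  assumes "\<not> (\<exists>m. \<forall>x\<in>X. g x \<le> m)" and "finite \<F>" and "\<F> \<subseteq> level_cover X g"
  shows "\<Union>\<F> \<noteq> X"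
proof
  assume "\<Union>\<F> = X"
  moreover obtain m where "\<forall>V\<in>\<F>. V \<subseteq> {x \<in> X. g x \<le> m}"
    using finite_subset_level_cover[OF assms(2,3)] ..
  ultimately have "\<forall>x\<in>X. g x \<le> m"
    by blast
  with assms(1) show False
    by blast
qed

lemma Union_level_cover: "\<Union> (level_cover X g) = X"
  by (auto simp: level_cover_def)

lemma level_cover_borel_gamma:
  fixes X :: "'a::topological_space set"
  assumes meas: "\<And>m. {x \<in> X. g x \<le> m} \<in> sets (restrict_space borel X)"
    and unbounded: "\<not> (\<exists>m. \<forall>x\<in>X. g x \<le> m)"
  shows "level_cover X g \<in> borel_gamma_covers X"
proof -
  \<comment> \<open>Both this and infinitude come from the absence of finite subcovers, applied to
    \<open>{X}\<close> and to the cover itself. Infinitude is a real claim, since different levels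
    may give the same set.\<close>
  have "X \<notin> level_cover X g"
    using no_finite_subcover_level_cover[OF unbounded, of "{X}"] by auto
  moreover have "infinite (level_cover X g)"
    using no_finite_subcover_level_cover[OF unbounded, of "level_cover X g"]
    by (auto simp: Union_level_cover)
  moreover have "finite {U \<in> level_cover X g. x \<notin> U}" if "x \<in> X" for x
  proof (rule finite_subset)
    \<comment> \<open>Only the sublevel sets of levels below \<open>g x\<close> omit
      \<open>x\<close>.\<close>
    show "{U \<in> level_cover X g. x \<notin> U} \<subseteq> (\<lambda>m. {x \<in> X. g x \<le> m}) ` {..<g x}"
    proof
      fix U assume "U \<in> {U \<in> level_cover X g. x \<notin> U}"
      then obtain m where "U = {x \<in> X. g x \<le> m}" "x \<notin> U"
        unfolding level_cover_def by blast
      with that show "U \<in> (\<lambda>m. {x \<in> X. g x \<le> m}) ` {..<g x}"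
        by (intro image_eqI[of _ _ m]) simp_all
    qed
  qed simp
  moreover have "countable_borel_family X (level_cover X g)"
    using meas by (auto simp: countable_borel_family_def level_cover_def)
  ultimately show ?thesis
    by (simp add: borel_gamma_covers_def gamma_cover_def is_cover_def Union_level_cover)
qed

lemma borel_coordinate_sets:
  fixes X :: "'a::topological_space set" and f :: "'a \<Rightarrow> nat \<Rightarrow> nat"
  assumes "f \<in> borel_measurable (restrict_space borel X)"
  shows "{x \<in> X. f x n \<le> m} \<in> sets (restrict_space borel X)"
proof -
  have "(\<lambda>x. f x n) \<in> borel_measurable (restrict_space borel X)"
    using measurable_compose[OF assms measurable_product_coordinates] .
  then have "(\<lambda>x. f x n) -` {..m} \<inter> space (restrict_space borel X)
    \<in> sets (restrict_space borel X)"
    by (rule measurable_sets) simp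
  moreover have "(\<lambda>x. f x n) -` {..m} \<inter> space (restrict_space borel X) = {x \<in> X. f x n \<le> m}"
    by (auto simp: space_restrict_space)
  ultimately show ?thesis
    by simp
qed

section \<open>From finite selections to the weak excluded middle property\<close>

text \<open>With \<open>h\<close> a bound on each bounded coordinate, every
  \<open>le_set (f x) h\<close> contains the same infinite set \<open>B\<close>, so a constant
  refinement is possible.\<close>

lemma weak_excluded_middle_if_infinitely_many_bounded:
  assumes "infinite {n. \<exists>m. \<forall>x\<in>X. f x n \<le> m}"
  shows "weak_excluded_middle (f ` X)"
proof -
  define B where "B = {n. \<exists>m. \<forall>x\<in>X. f x n \<le> m}"
  obtain h where "\<forall>n\<in>B. \<forall>x\<in>X. f x n \<le> h n"
    using bchoice[of B "\<lambda>n m. \<forall>x\<in>X. f x n \<le> m"] by (auto simp: B_def)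
  then show ?thesis
    using assms
    by (intro weak_excluded_middle_imageI[of X "\<lambda>_. B" f h])
      (auto simp flip: B_def simp: le_set_def almost_subset_def)
qed

text \<open>A common form of the hypotheses of \<open>S_fin\<close> and \<open>U_fin\<close>:
  \<open>\<G> n\<close> collects what the \<open>n\<close>-th selection contributes to the final
  cover, namely the members of \<open>\<F> n\<close> in the first case and the single set
  \<open>\<Union>(\<F> n)\<close> in the second.\<close>

lemma weak_excluded_middle_if_selection:
  fixes X :: "'a::topological_space set" and f :: "'a \<Rightarrow> nat \<Rightarrow> nat"
  assumes meas: "f \<in> borel_measurable (restrict_space borel X)"
    and select: "\<And>\<U> :: nat \<Rightarrow> 'a set set.
      (\<And>n. \<U> n \<in> borel_gamma_covers X) \<Longrightarrow>
      (\<And>n \<F>. finite \<F> \<Longrightarrow> \<F> \<subseteq> \<U> n \<Longrightarrow> \<Union>\<F> \<noteq> X) \<Longrightarrow>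
      \<exists>\<F> \<G>. (\<forall>n. finite (\<F> n) \<and> \<F> n \<subseteq> \<U> n) \<and>
        (\<forall>n. finite (\<G> n) \<and> (\<forall>V\<in>\<G> n. V \<subseteq> \<Union>(\<F> n))) \<and> tau_star_cover X (\<Union>n. \<G> n)"
  shows "weak_excluded_middle (f ` X)"
proof (cases "finite {n. \<exists>m. \<forall>x\<in>X. f x n \<le> m}")
  case False
  then show ?thesis
    by (rule weak_excluded_middle_if_infinitely_many_bounded)
next
  case True
  \<comment> \<open>Beyond \<open>N\<close> every coordinate is unbounded, so the level covers of
    the coordinates \<open>n + N\<close> are gamma-covers without finite subcovers.\<close>
  then obtain N where N: "\<forall>n\<in>{n. \<exists>m. \<forall>x\<in>X. f x n \<le> m}. n < N"
    using finite_nat_set_iff_bounded by blast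
  have unbounded: "\<not> (\<exists>m. \<forall>x\<in>X. f x (n + N) \<le> m)" for n
  proof
    assume "\<exists>m. \<forall>x\<in>X. f x (n + N) \<le> m"
    with N have "n + N < N"
      by blast
    then show False
      by simp
  qed
  have "\<exists>\<F> \<G>. (\<forall>n. finite (\<F> n) \<and> \<F> n \<subseteq> level_cover X (\<lambda>x. f x (n + N))) \<and>
      (\<forall>n. finite (\<G> n) \<and> (\<forall>V\<in>\<G> n. V \<subseteq> \<Union>(\<F> n))) \<and> tau_star_cover X (\<Union>n. \<G> n)"
  proof (rule select)
    show "level_cover X (\<lambda>x. f x (n + N)) \<in> borel_gamma_covers X" for n
      by (intro level_cover_borel_gamma borel_coordinate_sets meas unbounded)
    show "\<Union>\<F> \<noteq> X" if "finite \<F>" "\<F> \<subseteq> level_cover X (\<lambda>x. f x (n + N))" for n \<F>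
      using unbounded that by (rule no_finite_subcover_level_cover)
  qed
  then obtain \<F> \<G>
    where \<F>: "\<forall>n. finite (\<F> n) \<and> \<F> n \<subseteq> level_cover X (\<lambda>x. f x (n + N))"
      and \<G>: "\<forall>n. finite (\<G> n) \<and> (\<forall>V\<in>\<G> n. V \<subseteq> \<Union>(\<F> n))"
      and tau: "tau_star_cover X (\<Union>n. \<G> n)"
    by (elim exE conjE)
  have "\<forall>n. \<exists>m. \<forall>V\<in>\<F> n. V \<subseteq> {x \<in> X. f x (n + N) \<le> m}"
    using finite_subset_level_cover \<F> by blast
  then obtain h where h: "\<And>n V. V \<in> \<F> n \<Longrightarrow> V \<subseteq> {x \<in> X. f x (n + N) \<le> h n}"
    by metis
  \<comment> \<open>the covers for different coordinates may share members, so an index has to be chosen\<close>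
  define c where "c V = (SOME n. V \<in> \<G> n)" for V
  have c: "V \<in> \<G> (c V)" if "V \<in> (\<Union>n. \<G> n)" for V
    using that unfolding c_def by (auto intro: someI)
  show ?thesis
  \<comment> \<open>The shift by \<open>N\<close> is undone here. For \<open>n < N\<close> truncated
    subtraction yields the value \<open>h 0\<close>, which is harmless, as no member is assigned to
    such a coordinate.\<close>
  proof (rule weak_excluded_middle_if_tau_star_cover[OF tau,
        of f "\<lambda>V. c V + N" "\<lambda>n. h (n - N)"])
    fix V assume "V \<in> (\<Union>n. \<G> n)"
    then have "V \<subseteq> \<Union>(\<F> (c V))"
      using c \<G> by blast
    then show "V \<subseteq> {x. f x (c V + N) \<le> h (c V + N - N)}"
      using h[of _ "c V"] by auto
  next
    fix n
    show "finite {V \<in> (\<Union>n. \<G> n). c V + N = n}"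
    proof (rule finite_subset)
      show "{V \<in> (\<Union>n. \<G> n). c V + N = n} \<subseteq> \<G> (n - N)"
      proof
        fix V assume "V \<in> {V \<in> (\<Union>n. \<G> n). c V + N = n}"
        then show "V \<in> \<G> (n - N)"
          using c[of V] by auto
      qed
      show "finite (\<G> (n - N))"
        using \<G> by simp
    qed
  qed
qed

lemma weak_excluded_middle_if_S_fin:
  fixes X :: "'a::topological_space set"
  assumes "S_fin (borel_gamma_covers X) (borel_tau_star_covers X)"
    and "borel_image_in_Baire X Y"
  shows "weak_excluded_middle Y"
proof -
  obtain f where f: "f \<in> borel_measurable (restrict_space borel X)" and Y: "Y = f ` X"
    using assms(2) by (auto simp: borel_image_in_Baire_def)
  show ?thesis
    unfolding Y
  proof (rule weak_excluded_middle_if_selection[OF f])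
    fix \<U> :: "nat \<Rightarrow> 'a set set"
    assume "\<And>n. \<U> n \<in> borel_gamma_covers X"
    then have "\<exists>\<F>. (\<forall>n. finite (\<F> n) \<and> \<F> n \<subseteq> \<U> n) \<and> (\<Union>n. \<F> n) \<in> borel_tau_star_covers X"
      using assms(1)[unfolded S_fin_def, rule_format, of \<U>] by simp
    then obtain \<F> where "\<forall>n. finite (\<F> n) \<and> \<F> n \<subseteq> \<U> n" "tau_star_cover X (\<Union>n. \<F> n)"
      by (auto simp: borel_tau_star_covers_def)
    then show "\<exists>\<F> \<G>. (\<forall>n. finite (\<F> n) \<and> \<F> n \<subseteq> \<U> n) \<and>
        (\<forall>n. finite (\<G> n) \<and> (\<forall>V\<in>\<G> n. V \<subseteq> \<Union>(\<F> n))) \<and> tau_star_cover X (\<Union>n. \<G> n)"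
      by (intro exI[of _ \<F>] conjI allI ballI) auto
  qed
qed

lemma weak_excluded_middle_if_U_fin:
  fixes X :: "'a::topological_space set"
  assumes "U_fin X (borel_gamma_covers X) (borel_tau_star_covers X)"
    and "borel_image_in_Baire X Y"
  shows "weak_excluded_middle Y"
proof -
  obtain f where f: "f \<in> borel_measurable (restrict_space borel X)" and Y: "Y = f ` X"
    using assms(2) by (auto simp: borel_image_in_Baire_def)
  show ?thesis
    unfolding Y
  proof (rule weak_excluded_middle_if_selection[OF f])
    fix \<U> :: "nat \<Rightarrow> 'a set set"
    assume "\<And>n. \<U> n \<in> borel_gamma_covers X"
      "\<And>n \<F>. finite \<F> \<Longrightarrow> \<F> \<subseteq> \<U> n \<Longrightarrow> \<Union>\<F> \<noteq> X"
    then have "\<forall>n. \<U> n \<in> borel_gamma_covers X \<and> \<not> (\<exists>\<G>. finite \<G> \<and> \<G> \<subseteq> \<U> n \<and> \<Union>\<G> = X)"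
      by blast
    with assms(1)[unfolded U_fin_def, THEN spec, of \<U>]
    obtain \<F> where "\<forall>n. finite (\<F> n) \<and> \<F> n \<subseteq> \<U> n"
      "range (\<lambda>n. \<Union>(\<F> n)) \<in> borel_tau_star_covers X"
      by auto
    moreover from this(2) have "tau_star_cover X (\<Union>n. {\<Union>(\<F> n)})"
      by (simp add: borel_tau_star_covers_def UNION_singleton_eq_range)
    ultimately show "\<exists>\<F> \<G>. (\<forall>n. finite (\<F> n) \<and> \<F> n \<subseteq> \<U> n) \<and>
        (\<forall>n. finite (\<G> n) \<and> (\<forall>V\<in>\<G> n. V \<subseteq> \<Union>(\<F> n))) \<and> tau_star_cover X (\<Union>n. \<G> n)"
      by (intro exI[of _ \<F>] exI[of _ "\<lambda>n. {\<Union>(\<F> n)}"]) simp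
  qed
qed

section \<open>From the weak excluded middle property to single selections\<close>

lemma borel_measurable_into_BaireI:
  fixes f :: "'a \<Rightarrow> nat \<Rightarrow> nat"
  assumes "\<And>n m. {x \<in> space M. f x n \<le> m} \<in> sets M"
  shows "f \<in> borel_measurable M"
  using assms by (intro measurable_coordinatewise_then_product borel_measurableI_le)

text \<open>\<open>H\<close> is chosen recursively: \<open>U n\<close> takes infinitely many values
  on \<open>{h n..}\<close>, and only the finitely many values chosen earlier have to be
  avoided.\<close>

lemma exists_larger_distinct_selection:
  fixes U :: "nat \<Rightarrow> nat \<Rightarrow> 'b"
  assumes "\<And>n. inj (U n)"
  obtains H where "\<And>n. h n \<le> H n" and "inj (\<lambda>n. U n (H n))"
proof -
  have step: "\<exists>m. h n \<le> m \<and> (\<forall>i<n. U n m \<noteq> U i (g i))" for n and g :: "nat \<Rightarrow> nat"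
  proof (rule ccontr)
    assume "\<not> ?thesis"
    then have "U n ` {h n..} \<subseteq> (\<lambda>i. U i (g i)) ` {..<n}"
      by auto
    then have "finite (U n ` {h n..})"
      using finite_subset by blast
    moreover have "inj_on (U n) {h n..}"
      using assms inj_on_subset by blast
    ultimately show False
      using finite_imageD infinite_Ici by blast
  qed
  have "\<exists>H. \<forall>n. h n \<le> H n \<and> (\<forall>i<n. U n (H n) \<noteq> U i (H i))"
    by (rule dependent_wellorder_choice) (use step in auto)
  then obtain H where H: "\<And>n. h n \<le> H n \<and> (\<forall>i<n. U n (H n) \<noteq> U i (H i))"
    by blast
  have "inj (\<lambda>n. U n (H n))"
    by (rule injI) (metis H linorder_neqE_nat)
  with H that show thesis
    by blast
qed

lemma S_one_if_weak_excluded_middle: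
  fixes X :: "'a::topological_space set"
  assumes wem: "\<And>Y. borel_image_in_Baire X Y \<Longrightarrow> weak_excluded_middle Y"
  shows "S_one (borel_gamma_covers X) (borel_tau_star_covers X)"
  unfolding S_one_def
proof (intro allI impI)
  fix \<U> :: "nat \<Rightarrow> 'a set set"
  assume \<U>: "\<forall>n. \<U> n \<in> borel_gamma_covers X"
  define U where "U n = from_nat_into (\<U> n)" for n
  have bij: "bij_betw (U n) UNIV (\<U> n)" for n
    using \<U> bij_betw_from_nat_into[of "\<U> n"]
    by (auto simp: U_def borel_gamma_covers_def gamma_cover_def countable_borel_family_def)
  then have inj: "inj (U n)" and mem: "U n m \<in> \<U> n" for n m
    by (auto simp: bij_betw_def)
  have sets: "U n m \<in> sets (restrict_space borel X)" for n m
    using \<U> mem[of n m] by (auto simp: borel_gamma_covers_def countable_borel_family_def)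
  have sub: "U n m \<subseteq> X" and neq: "U n m \<noteq> X" for n m
    using \<U> mem[of n m] by (auto simp: borel_gamma_covers_def gamma_cover_def is_cover_def)
  have fin: "finite {m. x \<notin> U n m}" if "x \<in> X" for x n
  proof (rule finite_imageD)
    have "finite {V \<in> \<U> n. x \<notin> V}"
      using \<U> that by (auto simp: borel_gamma_covers_def gamma_cover_def)
    then show "finite (U n ` {m. x \<notin> U n m})"
      by (rule finite_subset[rotated]) (use mem in auto)
    show "inj_on (U n) {m. x \<notin> U n m}"
      using inj inj_on_subset by blast
  qed
  \<comment> \<open>The index from which on all members of the \<open>n\<close>-th cover contain
    \<open>x\<close>. It exists for \<open>x \<in> X\<close>, since only finitely many members omit
    \<open>x\<close>. Asking for a whole tail makes the condition monotone in \<open>k\<close>, so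
    that \<open>h\<close> can be enlarged later.\<close>
  define f where "f x n = (LEAST k. \<forall>m\<ge>k. x \<in> U n m)" for x n
  have f_le: "f x n \<le> k \<longleftrightarrow> (\<forall>m\<ge>k. x \<in> U n m)" if "x \<in> X" for x n k
  proof
    assume "\<forall>m\<ge>k. x \<in> U n m"
    then show "f x n \<le> k"
      unfolding f_def by (rule Least_le)
  next
    have "\<exists>k. \<forall>m\<ge>k. x \<in> U n m"
      using fin[OF that, of n] unfolding finite_nat_set_iff_bounded
      by (metis mem_Collect_eq not_less)
    then have "\<forall>m\<ge>f x n. x \<in> U n m"
      unfolding f_def by (rule LeastI_ex)
    then show "f x n \<le> k \<Longrightarrow> \<forall>m\<ge>k. x \<in> U n m"
      by auto
  qed
  have "f \<in> borel_measurable (restrict_space borel X)"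
  proof (rule borel_measurable_into_BaireI)
    fix n k
    \<comment> \<open>The tail condition turns this set into a countable intersection of Borel sets.
      The index set contains \<open>k\<close>, which keeps the intersection inside
      \<open>X\<close>.\<close>
    have "{x \<in> space (restrict_space borel X). f x n \<le> k} = (\<Inter>m\<in>{k..}. U n m)"
      using f_le sub[of n k] by (auto simp: space_restrict_space)
    also have "\<dots> \<in> sets (restrict_space borel X)"
      using sets by (intro sets.countable_INT') auto
    finally show "{x \<in> space (restrict_space borel X). f x n \<le> k}
      \<in> sets (restrict_space borel X)" .
  qed
  then have "weak_excluded_middle (f ` X)"
    using wem by (auto simp: borel_image_in_Baire_def)
  then obtain h where "linearly_refinable ((\<lambda>x. le_set (f x) h) ` X)"
    unfolding weak_excluded_middle_def image_image by blast
  then obtain R where R: "\<And>x. x \<in> X \<Longrightarrow> infinite (R x) \<and> R x \<subseteq> le_set (f x) h"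
    and lin: "\<And>x y. x \<in> X \<Longrightarrow> y \<in> X \<Longrightarrow> R x \<subseteq>\<^sup>* R y \<or> R y \<subseteq>\<^sup>* R x"
    by (rule linearly_refinable_imageE) blast
  obtain H where H: "\<And>n. h n \<le> H n" and inj_u: "inj (\<lambda>n. U n (H n))"
    using exists_larger_distinct_selection[of U h] inj by blast
  define u where "u n = U n (H n)" for n
  have inj_u: "inj u"
    using inj_u by (simp add: u_def[abs_def])
  have R_sub: "R x \<subseteq> marczewski_map u x" if "x \<in> X" for x
  proof
    fix n assume "n \<in> R x"
    then have "f x n \<le> H n"
      using R[OF that] H[of n] by (force simp: le_set_def)
    then show "n \<in> marczewski_map u x"
      using f_le[OF that] by (auto simp: marczewski_map_def u_def)
  qed
  have large: "infinite {V \<in> range u. x \<in> V}" if "x \<in> X" for x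
  proof -
    have "infinite (u ` R x)"
      using R[OF that] inj_u by (meson finite_imageD inj_on_subset subset_UNIV)
    moreover have "u ` R x \<subseteq> {V \<in> range u. x \<in> V}"
      using R_sub[OF that] by (auto simp: marczewski_map_def)
    ultimately show ?thesis
      using infinite_super by blast
  qed
  have "\<Union>(range u) = X"
  proof
    show "X \<subseteq> \<Union>(range u)"
      using large not_finite_existsD by blast
    show "\<Union>(range u) \<subseteq> X"
      using sub by (auto simp: u_def)
  qed
  moreover have "X \<notin> range u"
    using neq by (auto simp: u_def)
  moreover have "linearly_refinable (marczewski_map u ` X)"
    using R R_sub lin by (intro linearly_refinable_imageI[of X R]) auto
  moreover have "bij_betw u UNIV (range u)"
    using inj_u by (simp add: inj_on_imp_bij_betw)
  ultimately have "tau_star_cover X (range u)"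
    using large unfolding tau_star_cover_def large_cover_def is_cover_def by blast
  then have "range u \<in> borel_tau_star_covers X"
    using sets by (auto simp: borel_tau_star_covers_def countable_borel_family_def u_def)
  moreover have "\<forall>n. u n \<in> \<U> n"
    using mem by (simp add: u_def)
  ultimately show "\<exists>u. (\<forall>n. u n \<in> \<U> n) \<and> range u \<in> borel_tau_star_covers X"
    by blast
qed

section \<open>Closing the cycle of implications\<close>

lemma S_one_imp_S_fin:
  assumes "S_one \<AA> \<BB>"
  shows "S_fin \<AA> \<BB>"
  unfolding S_fin_def
proof (intro allI impI)
  fix \<U> :: "nat \<Rightarrow> 'a set set" assume "\<forall>n. \<U> n \<in> \<AA>"
  then obtain u where "\<forall>n. u n \<in> \<U> n" "range u \<in> \<BB>"
    using assms unfolding S_one_def by blast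
  then show "\<exists>\<F>. (\<forall>n. finite (\<F> n) \<and> \<F> n \<subseteq> \<U> n) \<and> (\<Union>n. \<F> n) \<in> \<BB>"
    by (intro exI[of _ "\<lambda>n. {u n}"]) (auto simp: UNION_singleton_eq_range)
qed

lemma S_one_imp_U_fin:
  assumes "S_one \<AA> \<BB>"
  shows "U_fin X \<AA> \<BB>"
  unfolding U_fin_def
proof (intro allI impI)
  fix \<U> :: "nat \<Rightarrow> 'a set set"
  assume "\<forall>n. \<U> n \<in> \<AA> \<and> \<not> (\<exists>\<G>. finite \<G> \<and> \<G> \<subseteq> \<U> n \<and> \<Union>\<G> = X)"
  then obtain u where "\<forall>n. u n \<in> \<U> n" "range u \<in> \<BB>"
    using assms unfolding S_one_def by blast
  then show "\<exists>\<F>. (\<forall>n. finite (\<F> n) \<and> \<F> n \<subseteq> \<U> n) \<and> range (\<lambda>n. \<Union>(\<F> n)) \<in> \<BB>"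
    \<comment> \<open>The union of the singleton \<open>{u n}\<close> is \<open>u n\<close>, so the
      family of unions is again \<open>range u\<close>.\<close>
    by (intro exI[of _ "\<lambda>n. {u n}"]) auto
qed

theorem theorem7p13:
  fixes X :: "real set"
  assumes "infinite X"
  shows "(S_one (borel_gamma_covers X) (borel_tau_star_covers X)
            \<longleftrightarrow> S_fin (borel_gamma_covers X) (borel_tau_star_covers X))
       \<and> (S_fin (borel_gamma_covers X) (borel_tau_star_covers X)
            \<longleftrightarrow> U_fin X (borel_gamma_covers X) (borel_tau_star_covers X))
       \<and> (U_fin X (borel_gamma_covers X) (borel_tau_star_covers X)
            \<longleftrightarrow> (\<forall>Y. borel_image_in_Baire X Y \<longrightarrow> weak_excluded_middle Y))"
  \<comment> \<open>Two cycles: single selections give both kinds of finite selection, each of these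
    gives the weak excluded middle property of all Borel images, and that property gives single
    selections back.\<close>
  using S_one_imp_S_fin[of "borel_gamma_covers X" "borel_tau_star_covers X"]
    S_one_imp_U_fin[of "borel_gamma_covers X" "borel_tau_star_covers X" X]
    weak_excluded_middle_if_S_fin[of X] weak_excluded_middle_if_U_fin[of X]
    S_one_if_weak_excluded_middle[of X]
  by blast

end
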